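(* Let $\mathcal{G}=([n],E)$ be a simple graph, let $\mathcal{D}=\{S\subseteq[n] : \{i,j\}\in E \text{ for all distinct } i,j\in S\}$ be the downset of all cliques of $\mathcal{G}$, and let $G$ be a subgroup of the automorphism group of $\mathcal{G}$. Let $\mathcal{F}\subseteq\mathcal{D}$ be a family of feasible subsets (an antichain), and assume that each feasible $S\in\mathcal{F}$ is a maximal clique in $\mathcal{G}$ (not necessarily vice versa). Let $H$ be a subgroup of the symmetric group $\mathrm{Sym}(n)$ and let $\mathcal{G}_H$ be the $H$-compatibility graph of $\mathcal{G}$. Let $S$ be a feasible subset of pairwise $H$-compatible elements. Then $S$ is an $H$-invariant feasible subset. In particular, the algorithm symmetric lexicographic subset reverse search for feasible subsets, applied to the downset $\mathcal{D}_H$ of all cliques of the $H$-compatibility graph $\mathcal{G}_H$ with unaltered feasibility check, enumerates all $H$-invariant feasible subsets of $\mathcal{D}$ up to $H$-feasible symmetries.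
   Context: Notation: $[n]=\{1,\dots,n\}$; permutations in $\mathrm{Sym}(n)$ act on subsets of $[n]$ elementwise; the $H$-orbit of $i$ is $Hi=\{h(i):h\in H\}$. Elements $i,j$ with $\{i,j\}\in E$ are compatible. A subset $S\in\mathcal{D}$ is $H$-invariant if $h(S)=S$ for each $h\in H$. An element $i\in[n]$ is $H$-feasible if its $H$-orbit is a clique in $\mathcal{G}$, i.e., for each $h\in H$ either $h(i)=i$ or $\{h(i),i\}\in E$. Two $H$-feasible elements $i,j$ are $H$-compatible if the union of their $H$-orbits is a clique in $\mathcal{G}$, i.e., for each $h\in H$ and all $k,\ell\in Hi\cup Hj$ either $h(k)=\ell$ or $\{h(k),\ell\}\in E$. (A set of pairwise $H$-compatible elements consists of $H$-feasible elements.) The $H$-compatibility graph $\mathcal{G}_H$ has as nodes the $H$-feasible elements and as edges the $\{i,j\}\in E$ such that $i$ and $j$ are $H$-compatible. A permutation $g\in G$ is $H$-feasible (an $H$-feasible symmetry) if for all $i\in[n]$: $g(i)$ is $H$-feasible if and only if $i$ is $H$-feasible. Lexicographic order on subsets of $[n]$: $\emptyset\prec S$ for all $S\ne\emptyset$; for non-empty $S,R$, $S\prec R$ iff $\min S<\min R$, or $\min S=\min R$ and $S\setminus\{\min S\}\prec R\setminus\{\min R\}$. A subset is canonical if it is lexicographically minimal in its orbit under the given symmetry group. $S'$ lex-contains $S$ if $S\subseteq S'$ and every element of $S'\setminus S$ is larger than every element of $S$. The algorithm (for a downset, a family of feasible subsets, and a symmetry group) is the following recursion, started at $S=\emptyset$: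 if $S$ is feasible, output $S$ and return. Otherwise, for each $j>\max S$ (in increasing order) such that $S\cup\{j\}$ is in the downset, put $S'=S\cup\{j\}$; skip $S'$ if it is not lexicographically minimal in its orbit; skip $S'$ if a (correct but possibly incomplete) test certifies that no feasible subset lex-contains $S'$; otherwise recurse on $S'$. (The loop may also be left early if it is certified that no further expansion can lead to a feasible subset.) Enumerating a family up to a group of symmetries means outputting exactly one (the canonical) representative of each orbit.
   Formalization: The output is shown to be exactly the canonical H-invariant feasible subsets; that this gives one representative per orbit is claimed only if the group of H-feasible symmetries maps the family of H-invariant feasible subsets to itself, since otherwise the claim can fail (e.g. on a 4-cycle). *)

theory Defs
  imports "HOL-Algebra.Sym_Groups"
begin

section \<open>Graphs, cliques and automorphisms\<close>

definition simple_graph :: "nat set \<Rightarrow> nat set set \<Rightarrow> bool" where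
  "simple_graph V E \<longleftrightarrow> (\<forall>e\<in>E. e \<subseteq> V \<and> card e = 2)"

definition cliques :: "nat set \<Rightarrow> nat set set \<Rightarrow> nat set set" where
  "cliques V E = {S. S \<subseteq> V \<and> (\<forall>i\<in>S. \<forall>j\<in>S. i \<noteq> j \<longrightarrow> {i, j} \<in> E)}"

definition maximal_clique :: "nat set \<Rightarrow> nat set set \<Rightarrow> nat set \<Rightarrow> bool" where
  "maximal_clique V E S \<longleftrightarrow> S \<in> cliques V E \<and> (\<forall>T\<in>cliques V E. S \<subseteq> T \<longrightarrow> T = S)"

definition graph_automorphisms :: "nat set \<Rightarrow> nat set set \<Rightarrow> (nat \<Rightarrow> nat) set" where
  "graph_automorphisms V E =
     {g. g permutes V \<and> (\<forall>i\<in>V. \<forall>j\<in>V. {g i, g j} \<in> E \<longleftrightarrow> {i, j} \<in> E)}"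

definition antichain :: "nat set set \<Rightarrow> bool" where
  "antichain F \<longleftrightarrow> (\<forall>S\<in>F. \<forall>T\<in>F. \<not> S \<subset> T)"


section \<open>Prescribed symmetry\<close>

definition pt_orbit :: "(nat \<Rightarrow> nat) set \<Rightarrow> nat \<Rightarrow> nat set" where
  "pt_orbit H i = {h i | h. h \<in> H}"

definition set_orbit :: "(nat \<Rightarrow> nat) set \<Rightarrow> nat set \<Rightarrow> nat set set" where
  "set_orbit H S = {h ` S | h. h \<in> H}"

definition H_invariant :: "(nat \<Rightarrow> nat) set \<Rightarrow> nat set \<Rightarrow> bool" where
  "H_invariant H S \<longleftrightarrow> (\<forall>h\<in>H. h ` S = S)"

text \<open>Since \<open>H\<close> need not act by automorphisms, it is not enough that \<open>i\<close> itself is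
  adjacent to the other members of its orbit; the whole orbit has to be a clique.\<close>

definition H_feasible :: "nat \<Rightarrow> nat set set \<Rightarrow> (nat \<Rightarrow> nat) set \<Rightarrow> nat \<Rightarrow> bool" where
  "H_feasible n E H i \<longleftrightarrow> i \<in> {1..n} \<and> pt_orbit H i \<in> cliques {1..n} E"

definition H_compatible :: "nat \<Rightarrow> nat set set \<Rightarrow> (nat \<Rightarrow> nat) set \<Rightarrow> nat \<Rightarrow> nat \<Rightarrow> bool" where
  "H_compatible n E H i j \<longleftrightarrow>
     H_feasible n E H i \<and> H_feasible n E H j \<and>
     pt_orbit H i \<union> pt_orbit H j \<in> cliques {1..n} E"

text \<open>The case \<open>i = j\<close> is included, so that a one-element set of pairwise
  \<open>H\<close>-compatible elements also consists of an \<open>H\<close>-feasible element.\<close>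

definition pairwise_H_compatible ::
    "nat \<Rightarrow> nat set set \<Rightarrow> (nat \<Rightarrow> nat) set \<Rightarrow> nat set \<Rightarrow> bool" where
  "pairwise_H_compatible n E H S \<longleftrightarrow> (\<forall>i\<in>S. \<forall>j\<in>S. H_compatible n E H i j)"

definition H_nodes :: "nat \<Rightarrow> nat set set \<Rightarrow> (nat \<Rightarrow> nat) set \<Rightarrow> nat set" where
  "H_nodes n E H = {i. H_feasible n E H i}"

definition H_edges :: "nat \<Rightarrow> nat set set \<Rightarrow> (nat \<Rightarrow> nat) set \<Rightarrow> nat set set" where
  "H_edges n E H = {{i, j} | i j. {i, j} \<in> E \<and> H_compatible n E H i j}"

definition H_downset :: "nat \<Rightarrow> nat set set \<Rightarrow> (nat \<Rightarrow> nat) set \<Rightarrow> nat set set" where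
  "H_downset n E H = cliques (H_nodes n E H) (H_edges n E H)"

definition H_feasible_symmetries ::
    "nat \<Rightarrow> nat set set \<Rightarrow> (nat \<Rightarrow> nat) set \<Rightarrow> (nat \<Rightarrow> nat) set \<Rightarrow> (nat \<Rightarrow> nat) set" where
  "H_feasible_symmetries n E G H =
     {g \<in> G. \<forall>i\<in>{1..n}. H_feasible n E H (g i) \<longleftrightarrow> H_feasible n E H i}"

lemma subgroup_H_feasible_symmetries:
  assumes "subgroup G (sym_group n)"
  shows "subgroup (H_feasible_symmetries n E G H) (sym_group n)"
proof -
  interpret G: subgroup G "sym_group n" by (fact assms)
  have perm: "g permutes {1..n}" if "g \<in> G" for g
    using G.subset that by (auto simp: sym_group_carrier)
  have inv: "inv\<^bsub>sym_group n\<^esub> g = Hilbert_Choice.inv g" if "g \<in> G" for g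
    using G.subset that by (auto simp: sym_group_inv_equality)
  show ?thesis
  proof
    show "H_feasible_symmetries n E G H \<subseteq> carrier (sym_group n)"
      using G.subset by (auto simp: H_feasible_symmetries_def)
    show "\<one>\<^bsub>sym_group n\<^esub> \<in> H_feasible_symmetries n E G H"
      using G.one_closed by (auto simp: H_feasible_symmetries_def sym_group_one)
  next
    fix g k
    assume gk: "g \<in> H_feasible_symmetries n E G H" "k \<in> H_feasible_symmetries n E G H"
    then have "k i \<in> {1..n}" if "i \<in> {1..n}" for i
      using perm[of k] permutes_in_image[of k "{1..n}" i] that
      by (simp add: H_feasible_symmetries_def)
    then show "g \<otimes>\<^bsub>sym_group n\<^esub> k \<in> H_feasible_symmetries n E G H"
      using gk G.m_closed[of g k] by (auto simp: H_feasible_symmetries_def sym_group_mult)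
  next
    fix g
    assume g: "g \<in> H_feasible_symmetries n E G H"
    then have gG: "g \<in> G" by (simp add: H_feasible_symmetries_def)
    note p = perm[OF gG]
    have "H_feasible n E H (Hilbert_Choice.inv g i) \<longleftrightarrow> H_feasible n E H i"
      if "i \<in> {1..n}" for i
    proof -
      have "Hilbert_Choice.inv g i \<in> {1..n}"
        using permutes_in_image[OF permutes_inv[OF p], of i] that by simp
      then have "H_feasible n E H (g (Hilbert_Choice.inv g i)) \<longleftrightarrow>
                 H_feasible n E H (Hilbert_Choice.inv g i)"
        using g by (simp add: H_feasible_symmetries_def del: atLeastAtMost_iff)
      then show ?thesis by (simp add: permutes_inverses(1)[OF p])
    qed
    then show "inv\<^bsub>sym_group n\<^esub> g \<in> H_feasible_symmetries n E G H"
      using G.m_inv_closed[OF gG] inv[OF gG] by (simp add: H_feasible_symmetries_def)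
  qed
qed


section \<open>Lexicographic order\<close>

text \<open>The order is only meant for finite sets, where the recursion terminates.\<close>

inductive lex_less :: "nat set \<Rightarrow> nat set \<Rightarrow> bool" where
  empty: "S \<noteq> {} \<Longrightarrow> lex_less {} S"
| Min_less: "S \<noteq> {} \<Longrightarrow> R \<noteq> {} \<Longrightarrow> Min S < Min R \<Longrightarrow> lex_less S R"
| Min_eq: "S \<noteq> {} \<Longrightarrow> R \<noteq> {} \<Longrightarrow> Min S = Min R \<Longrightarrow>
    lex_less (S - {Min S}) (R - {Min R}) \<Longrightarrow> lex_less S R"

definition canonical :: "(nat \<Rightarrow> nat) set \<Rightarrow> nat set \<Rightarrow> bool" where
  "canonical K S \<longleftrightarrow> (\<forall>R\<in>set_orbit K S. R = S \<or> lex_less S R)"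

definition lex_contains :: "nat set \<Rightarrow> nat set \<Rightarrow> bool" where
  "lex_contains S' S \<longleftrightarrow> S \<subseteq> S' \<and> (\<forall>x\<in>S' - S. \<forall>y\<in>S. y < x)"


section \<open>Symmetric lexicographic subset reverse search\<close>

text \<open>The arguments are the ground set size \<open>n\<close>, the downset \<open>D\<close>, the feasibility
  check \<open>F\<close>, the symmetry group \<open>K\<close>, and two certificates: \<open>prune S'\<close> discards the
  candidate \<open>S'\<close>, and \<open>stop S j\<close> leaves the loop over the expansions of \<open>S\<close> before
  the element \<open>j\<close> is processed.  The result lists the outputs in order, with
  multiplicity; the search is started at \<open>S = {}\<close>.\<close>

function slsrs ::
    "nat \<Rightarrow> nat set set \<Rightarrow> nat set set \<Rightarrow> (nat \<Rightarrow> nat) set \<Rightarrow>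
     (nat set \<Rightarrow> bool) \<Rightarrow> (nat set \<Rightarrow> nat \<Rightarrow> bool) \<Rightarrow> nat set \<Rightarrow> nat set list" where
  "slsrs n D F K prune stop S =
     (if S \<in> F then [S]
      else concat (map
        (\<lambda>j. if insert j S \<in> D \<and> canonical K (insert j S) \<and> \<not> prune (insert j S)
              then slsrs n D F K prune stop (insert j S) else [])
        (takeWhile (\<lambda>j. \<not> stop S j) (filter (\<lambda>j. \<forall>i\<in>S. i < j) [1..<Suc n]))))"
  by pat_completeness auto
termination
proof (relation "measure (\<lambda>(n, D, F, K, prune, stop, S). card ({1..n} - S))", goal_cases)
  case 1
  then show ?case by simp
next
  case (2 n D F K prune stop S j)
  then have "j \<in> {1..n}" "\<forall>i\<in>S. i < j"
    by (auto dest!: set_takeWhileD)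
  then have "{1..n} - insert j S \<subset> {1..n} - S" by auto
  then show ?case by (simp add: psubset_card_mono)
qed

declare slsrs.simps [simp del]

definition correct_prune :: "nat set set \<Rightarrow> nat set set \<Rightarrow> (nat set \<Rightarrow> bool) \<Rightarrow> bool" where
  "correct_prune D F prune \<longleftrightarrow>
     (\<forall>S. prune S \<longrightarrow> \<not> (\<exists>R\<in>F \<inter> D. lex_contains R S))"

definition correct_stop ::
    "nat set set \<Rightarrow> nat set set \<Rightarrow> (nat set \<Rightarrow> nat \<Rightarrow> bool) \<Rightarrow> bool" where
  "correct_stop D F stop \<longleftrightarrow>
     (\<forall>S j. stop S j \<longrightarrow>
        \<not> (\<exists>k\<ge>j. (\<forall>i\<in>S. i < k) \<and> (\<exists>R\<in>F \<inter> D. lex_contains R (insert k S))))"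

definition outputs_canonical ::
    "(nat \<Rightarrow> nat) set \<Rightarrow> nat set set \<Rightarrow> nat set list \<Rightarrow> bool" where
  "outputs_canonical K X outs \<longleftrightarrow> distinct outs \<and> set outs = {S \<in> X. canonical K S}"

text \<open>\<open>K\<close> maps the family \<open>X\<close> to itself, so that \<open>X\<close> is a union of \<open>K\<close>-orbits
  and one can speak of representatives of the \<open>K\<close>-orbits of \<open>X\<close>.  This is not automatic:
  for the 4-cycle 1-2-3-4 with \<open>F\<close> its edges and \<open>H\<close> generated by (1 4)(2 3), every
  automorphism is an \<open>H\<close>-feasible symmetry, but a rotation maps the \<open>H\<close>-invariant set
  \<open>{1, 4}\<close> to \<open>{1, 2}\<close>, which is not \<open>H\<close>-invariant.\<close>

definition acts_on_family :: "(nat \<Rightarrow> nat) set \<Rightarrow> nat set set \<Rightarrow> bool" where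
  "acts_on_family K X \<longleftrightarrow> (\<forall>g\<in>K. \<forall>S\<in>X. g ` S \<in> X)"

definition enumerates_up_to ::
    "(nat \<Rightarrow> nat) set \<Rightarrow> nat set set \<Rightarrow> nat set list \<Rightarrow> bool" where
  "enumerates_up_to K X outs \<longleftrightarrow>
     outputs_canonical K X outs \<and>
     (\<forall>S\<in>X. \<exists>!R. R \<in> set outs \<and> R \<in> set_orbit K S)"

end

theory Submission
  imports Defs "HOL-Library.List_Lexorder"
begin

text \<open>If \<open>S\<close> is feasible with pairwise \<open>H\<close>-compatible elements, the union of the \<open>H\<close>-orbits of its
  elements is a clique containing \<open>S\<close>, hence equal to \<open>S\<close> by maximality; so \<open>S\<close> is \<open>H\<close>-invariant.
  Conversely an \<open>H\<close>-invariant clique contains the orbits of its elements, so it is a clique of the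
  compatibility graph.  The search is complete because an initial segment of a canonical set is
  canonical: if \<open>g\<close> made the segment \<open>T\<close> of \<open>S\<close> lexicographically smaller, the first difference would
  persist in \<open>g ` S\<close>, as \<open>T\<close> and \<open>g ` T\<close> have equal size.\<close>

section \<open>Lexicographic order\<close>

text \<open>In the increasing list of a finite set, \<open>Min\<close> is the head and removing it
  leaves the tail, so the three rules become the cases of \<open>lexord\<close>. The list view
  supplies asymmetry and totality of \<open>lex_less\<close>.\<close>

lemma lex_less_lexord:
  assumes "lex_less A B" "finite A" "finite B"
  shows "(sorted_list_of_set A, sorted_list_of_set B) \<in> lexord {(x, y). x < y}"
  using assms
  by (induction rule: lex_less.induct)
     (auto simp: sorted_list_of_set_nonempty neq_Nil_conv[symmetric])

lemma lexord_lex_less: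
  assumes "finite A" "finite B"
    "(sorted_list_of_set A, sorted_list_of_set B) \<in> lexord {(x, y). x < y}"
  shows "lex_less A B"
  using assms
proof (induction A arbitrary: B rule: finite_psubset_induct)
  case (psubset A)
  have B: "B \<noteq> {}" using psubset.prems by auto
  show ?case
  proof (cases "A = {}")
    case True
    then show ?thesis using B by (simp add: lex_less.empty)
  next
    case False
    then have "Min A < Min B \<or> Min A = Min B \<and>
        (sorted_list_of_set (A - {Min A}), sorted_list_of_set (B - {Min B}))
          \<in> lexord {(x, y). x < y}"
      using psubset B by (simp add: sorted_list_of_set_nonempty)
    moreover have "A - {Min A} \<subset> A"
      using False psubset.hyps Min_in by blast
    ultimately show ?thesis
      using psubset False B
      by (metis finite_Diff lex_less.Min_eq lex_less.Min_less)
  qed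
qed

lemma lex_less_iff_sorted_list:
  assumes "finite A" "finite B"
  shows "lex_less A B \<longleftrightarrow> sorted_list_of_set A < sorted_list_of_set B"
  using lex_less_lexord lexord_lex_less assms by (auto simp: list_less_def)

lemma lex_less_asym:
  assumes "finite A" "finite B" "lex_less A B"
  shows "\<not> lex_less B A"
  using assms by (simp add: lex_less_iff_sorted_list)

lemma lex_less_linear:
  assumes "finite A" "finite B"
  shows "A = B \<or> lex_less A B \<or> lex_less B A"
  using assms sorted_list_of_set_inject[of A B] by (auto simp: lex_less_iff_sorted_list)

section \<open>Initial segments and their extensions\<close>

lemma Min_lex_contains:
  assumes "lex_contains B' B" "B \<noteq> {}" "finite B'"
  shows "Min B' = Min B"
proof (rule Min_eqI)
  have "finite B" using assms by (auto simp: lex_contains_def intro: finite_subset)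
  then have "Min B \<in> B" using assms by simp
  then show "Min B \<in> B'" using assms by (auto simp: lex_contains_def)
  fix x assume "x \<in> B'"
  show "Min B \<le> x"
  proof (cases "x \<in> B")
    case True
    then show ?thesis using \<open>finite B\<close> by simp
  next
    case False
    then have "Min B < x"
      using \<open>x \<in> B'\<close> \<open>Min B \<in> B\<close> assms(1) unfolding lex_contains_def by blast
    then show ?thesis by simp
  qed
qed (use assms in simp)

text \<open>Equal size rules out that one increasing list is a proper prefix of the other, so there
  is a first position where \<open>A\<close> has the smaller entry. Enlarging \<open>A\<close> can
  only lower entries up to there, and what is added to \<open>B\<close> comes after all of
  \<open>B\<close>. \<open>A'\<close> may be any superset, since a permutation can interleave the
  image of a segment with the images of later elements.\<close>

lemma lex_less_extend:
  assumes "lex_less A B" "card A = card B" "finite A'" "finite B'"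
    "A \<subseteq> A'" "lex_contains B' B"
  shows "lex_less A' B'"
  using assms
proof (induction arbitrary: A' B' rule: lex_less.induct)
  case (empty B)
  \<comment> \<open>Equal cardinality makes this case void; finiteness comes first because an
    infinite set also has \<open>card\<close> 0.\<close>
  then have "finite B" by (auto simp: lex_contains_def intro: finite_subset)
  then show ?case using empty by simp
next
  case (Min_less A B)
  then have "Min A' \<le> Min A" "Min B' = Min B" "A' \<noteq> {}" "B' \<noteq> {}"
    using Min_lex_contains[of B' B] by (auto simp: lex_contains_def intro: Min_antimono)
  then show ?case
    using Min_less.hyps by (intro lex_less.Min_less) auto
next
  case (Min_eq A B)
  have fin: "finite A" "finite B"
    using Min_eq by (auto simp: lex_contains_def intro: finite_subset)
  have Min: "Min A' \<le> Min A" "Min B' = Min B"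
    using Min_eq.hyps(1,2) Min_eq.prems by (simp_all add: Min_antimono Min_lex_contains)
  have ne: "A' \<noteq> {}" "B' \<noteq> {}"
    using Min_eq.hyps(1,2) Min_eq.prems by (auto simp: lex_contains_def)
  \<comment> \<open>If the enlargement lowers the minimum of \<open>A\<close>, the minima already
    decide; the remainders are compared only when it stays.\<close>
  have "lex_less (A' - {Min A'}) (B' - {Min B'})" if eq: "Min A' = Min A"
  proof (rule Min_eq.IH)
    show "card (A - {Min A}) = card (B - {Min B})"
      using Min_eq.hyps(1,2) Min_eq.prems(1) fin by (simp add: card_Diff_singleton Min_in)
    show "lex_contains (B' - {Min B'}) (B - {Min B})"
      using Min(2) Min_eq.prems by (auto simp: lex_contains_def)
  qed (use Min_eq.prems eq in auto)
  then show ?case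
    using Min ne Min_eq.hyps by (metis lex_less.Min_eq lex_less.Min_less nat_less_le)
qed

lemma lex_contains_refl: "lex_contains S S"
  by (simp add: lex_contains_def)

lemma lex_contains_insertD:
  assumes "lex_contains R (insert j S)" "\<forall>i\<in>S. i < j"
  shows "lex_contains R S"
  using assms by (auto simp: lex_contains_def)

text \<open>If \<open>j\<close> < \<open>k\<close>, then \<open>j\<close> is an element of
  \<open>R\<close> outside \<open>insert k S\<close> that lies below \<open>k\<close>; symmetrically
  for \<open>k\<close> < \<open>j\<close>. This separates the branches of the search.\<close>

lemma lex_contains_insert_unique:
  assumes "lex_contains R (insert j S)" "lex_contains R (insert k S)"
    and "\<forall>i\<in>S. i < j" "\<forall>i\<in>S. i < k"
  shows "j = k"
  using assms unfolding lex_contains_def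
  by (metis Diff_iff insertCI insertE insert_subset less_asym)

text \<open>Provides the branch that leads from \<open>S\<close> towards \<open>R\<close>: the least
  missing element is the next one in increasing order.\<close>

lemma lex_contains_insert_Min:
  assumes "lex_contains R S" "finite R" "R \<noteq> S"
  defines "j \<equiv> Min (R - S)"
  shows "lex_contains R (insert j S)" "j \<in> R" "\<forall>i\<in>S. i < j"
proof -
  have "R - S \<noteq> {}" using assms by (auto simp: lex_contains_def)
  then have "j \<in> R - S" using assms Min_in[of "R - S"] by auto
  moreover have "j \<le> x" if "x \<in> R - S" for x
    using assms that by simp
  ultimately show "lex_contains R (insert j S)" "j \<in> R" "\<forall>i\<in>S. i < j"
    using assms(1) by (auto simp: lex_contains_def order_less_le)
qed


section \<open>Canonical sets\<close>

lemma canonical_empty: "canonical K {}"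
  by (auto simp: canonical_def set_orbit_def)

lemma canonical_initial_segment:
  assumes "canonical K R" "lex_contains R S" "finite R" "\<And>g. g \<in> K \<Longrightarrow> inj g"
  shows "canonical K S"
  unfolding canonical_def
proof
  fix Q assume "Q \<in> set_orbit K S"
  then obtain g where g: "g \<in> K" "Q = g ` S" by (auto simp: set_orbit_def)
  have "S \<subseteq> R" using assms by (simp add: lex_contains_def)
  then have "finite S" using assms finite_subset by blast
  have "\<not> lex_less Q S"
  proof
    assume "lex_less Q S"
    moreover have "card Q = card S"
      using g assms(4) by (auto intro: card_image inj_on_subset)
    ultimately have "lex_less (g ` R) R"
      using lex_less_extend assms g \<open>S \<subseteq> R\<close> by (metis finite_imageI image_mono)
    moreover have "g ` R = R \<or> lex_less R (g ` R)"
      using assms(1) g by (auto simp: canonical_def set_orbit_def)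
    ultimately show False
      using lex_less_asym assms(3) by (metis finite_imageI)
  qed
  then show "Q = S \<or> lex_less S Q"
    using lex_less_linear[of Q S] \<open>finite S\<close> g by auto
qed

section \<open>Canonical representatives of orbits\<close>

lemma subgroup_sym_group_permutes:
  assumes "subgroup K (sym_group n)" "g \<in> K"
  shows "g permutes {1..n}"
  using subgroup.subset[OF assms(1)] assms(2) by (auto simp: sym_group_carrier)

text \<open>Composing with \<open>g\<close> gives one inclusion and with its inverse the other.
  Canonicity of any orbit member can thus be tested within the orbit of \<open>S\<close>.\<close>

lemma set_orbit_sym_group:
  assumes "subgroup K (sym_group n)" "R \<in> set_orbit K S"
  shows "set_orbit K R = set_orbit K S"
proof -
  interpret K: subgroup K "sym_group n" by fact
  obtain g where g: "g \<in> K" "R = g ` S" using assms(2) by (auto simp: set_orbit_def)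
  note perm = subgroup_sym_group_permutes[OF assms(1) g(1)]
  have gi: "Hilbert_Choice.inv g \<in> K"
    using K.m_inv_closed[OF g(1)] subsetD[OF K.subset g(1)] by simp
  have comp: "h \<circ> k \<in> K" if "h \<in> K" "k \<in> K" for h k
    using K.m_closed[OF that] by (simp add: sym_group_mult)
  have "S = Hilbert_Choice.inv g ` R"
    using g permutes_inverses(2)[OF perm] by (simp add: image_image)
  then have S: "h ` S = (h \<circ> Hilbert_Choice.inv g) ` R" for h :: "nat \<Rightarrow> nat"
    by (simp add: image_comp)
  have R: "h ` R = (h \<circ> g) ` S" for h :: "nat \<Rightarrow> nat"
    using g by (simp add: image_comp)
  show ?thesis
  proof (intro equalityI subsetI)
    show "Q \<in> set_orbit K S" if "Q \<in> set_orbit K R" for Q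
      using that R comp[OF _ g(1)] unfolding set_orbit_def by force
    show "Q \<in> set_orbit K R" if "Q \<in> set_orbit K S" for Q
      using that S comp[OF _ gi] unfolding set_orbit_def by force
  qed
qed

text \<open>The representative is the minimum of a nonempty orbit, finite because
  \<open>{1..n}\<close> has finitely many permutations. Totality gives existence, asymmetry gives
  uniqueness.\<close>

lemma ex1_canonical_in_orbit:
  assumes K: "subgroup K (sym_group n)" and S: "finite S"
  shows "\<exists>!R. canonical K R \<and> R \<in> set_orbit K S"
proof (rule ex_ex1I)
  interpret K: subgroup K "sym_group n" by fact
  have "K \<subseteq> {g. g permutes {1..n}}" using subgroup_sym_group_permutes[OF K] by blast
  then have "finite K" using finite_permutations[of "{1..n}"] finite_subset by blast
  then have "finite (set_orbit K S)" by (simp add: set_orbit_def)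
  moreover have "set_orbit K S \<noteq> {}" using K.one_closed unfolding set_orbit_def by blast
  \<comment> \<open>Minimising over the increasing lists uses their linear order in place of
    \<open>lex_less\<close>.\<close>
  ultimately obtain R where R: "R \<in> set_orbit K S"
    "\<And>Q. Q \<in> set_orbit K S \<Longrightarrow> \<not> sorted_list_of_set Q < sorted_list_of_set R"
    using ex_min_if_finite[of "sorted_list_of_set ` set_orbit K S"] by auto
  have fin: "finite Q" if "Q \<in> set_orbit K S" for Q
    using that S by (auto simp: set_orbit_def)
  have "R = Q \<or> lex_less R Q" if "Q \<in> set_orbit K S" for Q
    using lex_less_linear[of R Q] R fin that by (auto simp: lex_less_iff_sorted_list)
  then have "canonical K R"
    unfolding canonical_def set_orbit_sym_group[OF K R(1)] by auto
  then show "\<exists>R. canonical K R \<and> R \<in> set_orbit K S" using R by blast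
next
  fix R Q assume RQ: "canonical K R \<and> R \<in> set_orbit K S" "canonical K Q \<and> Q \<in> set_orbit K S"
  then have "R = Q \<or> lex_less R Q" "R = Q \<or> lex_less Q R"
    using set_orbit_sym_group[OF K] by (auto simp: canonical_def)
  moreover have "finite R" "finite Q" using RQ S by (auto simp: set_orbit_def)
  ultimately show "R = Q" using lex_less_asym by blast
qed

text \<open>As \<open>K\<close> maps \<open>X\<close> to itself, the whole orbit of a member stays
  in \<open>X\<close>, so its canonical element is among the outputs.\<close>

lemma outputs_canonical_enumerates:
  assumes "subgroup K (sym_group n)" "outputs_canonical K X outs" "acts_on_family K X"
    "\<And>S. S \<in> X \<Longrightarrow> finite S"
  shows "enumerates_up_to K X outs"
proof -
  have "\<exists>!R. R \<in> set outs \<and> R \<in> set_orbit K S" if S: "S \<in> X" for S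
  proof -
    have "R \<in> set outs \<and> R \<in> set_orbit K S \<longleftrightarrow> canonical K R \<and> R \<in> set_orbit K S" for R
      using assms(2,3) S
      by (auto simp: outputs_canonical_def acts_on_family_def set_orbit_def)
    then show ?thesis using ex1_canonical_in_orbit assms(1,4) S by simp
  qed
  then show ?thesis using assms(2) by (simp add: enumerates_up_to_def)
qed


section \<open>Correctness of the search\<close>

lemma distinct_concat_map:
  assumes "distinct xs" "\<And>x. x \<in> set xs \<Longrightarrow> distinct (f x)"
    "\<And>x y. x \<in> set xs \<Longrightarrow> y \<in> set xs \<Longrightarrow> x \<noteq> y \<Longrightarrow> set (f x) \<inter> set (f y) = {}"
  shows "distinct (concat (map f xs))"
  using assms by (induction xs) fastforce+

text \<open>In a sorted list everything before \<open>x\<close> is at most \<open>x\<close>, so the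
  kept prefix cannot end before \<open>x\<close>.\<close>

lemma in_set_takeWhile_sorted:
  assumes "sorted xs" "x \<in> set xs" "\<And>y. y \<le> x \<Longrightarrow> P y"
  shows "x \<in> set (takeWhile P xs)"
  using assms by (induction xs) auto

text \<open>Every recursive call is guarded by the downset and canonicity tests, but the starting
  set is not; hence the exception for \<open>R = S\<close>.\<close>

lemma slsrs_sound:
  assumes "R \<in> set (slsrs n D F K prune stop S)"
  shows "lex_contains R S \<and> R \<in> F \<and> (R \<noteq> S \<longrightarrow> R \<in> D \<and> canonical K R)"
  using assms
proof (induction n D F K prune stop S arbitrary: R rule: slsrs.induct)
  case (1 n D F K prune stop S)
  show ?case
  proof (cases "S \<in> F")
    case True
    then show ?thesis using "1.prems" by (simp add: slsrs.simps[of _ _ _ _ _ _ S] lex_contains_refl)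
  next
    case False
    with "1.prems" obtain j where
      j: "j \<in> set (takeWhile (\<lambda>j. \<not> stop S j) (filter (\<lambda>j. \<forall>i\<in>S. i < j) [1..<Suc n]))"
      "insert j S \<in> D" "canonical K (insert j S)" "\<not> prune (insert j S)"
      "R \<in> set (slsrs n D F K prune stop (insert j S))"
      by (auto simp: slsrs.simps[of _ _ _ _ _ _ S] split: if_splits simp del: upt_Suc)
    have "\<forall>i\<in>S. i < j" using j(1) by (auto dest!: set_takeWhileD)
    then show ?thesis
      using "1.IH"[OF False j(1) _ j(5)] j(2-4) lex_contains_insertD by metis
  qed
qed

text \<open>Outputs of the branch at \<open>j\<close> lex-contain \<open>insert j S\<close>, so by
  \<open>lex_contains_insert_unique\<close> different branches share no output.\<close>

lemma slsrs_distinct: "distinct (slsrs n D F K prune stop S)"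
proof (induction n D F K prune stop S rule: slsrs.induct)
  case (1 n D F K prune stop S)
  show ?case
  proof (cases "S \<in> F")
    case True
    then show ?thesis by (simp add: slsrs.simps[of _ _ _ _ _ _ S])
  next
    case False
    have "distinct (concat (map
        (\<lambda>j. if insert j S \<in> D \<and> canonical K (insert j S) \<and> \<not> prune (insert j S)
              then slsrs n D F K prune stop (insert j S) else [])
        (takeWhile (\<lambda>j. \<not> stop S j) (filter (\<lambda>j. \<forall>i\<in>S. i < j) [1..<Suc n]))))"
    proof (rule distinct_concat_map, goal_cases)
      case 1
      show ?case by (intro distinct_takeWhile distinct_filter distinct_upt)
    next
      case (2 j)
      then show ?case using "1.IH"[OF False, of j] by auto
    next
      case (3 j k)
      then have "\<forall>i\<in>S. i < j" "\<forall>i\<in>S. i < k"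
        by (auto dest!: set_takeWhileD simp del: upt_Suc)
      then have "R \<notin> set (slsrs n D F K prune stop (insert k S))"
        if "R \<in> set (slsrs n D F K prune stop (insert j S))" for R
        using slsrs_sound[OF that] slsrs_sound[of R n D F K prune stop "insert k S"]
          lex_contains_insert_unique 3(3) by blast
      then show ?case by auto
    qed
    then show ?thesis using False by (subst slsrs.simps) (simp del: upt_Suc)
  qed
qed

text \<open>The recursion descends along the initial segments of \<open>R\<close>. Each passes the
  tests: \<open>D\<close> is closed under subsets, initial segments of canonical sets are canonical,
  and \<open>R\<close> itself refutes any pruning.\<close>

lemma slsrs_complete:
  assumes "R \<in> F \<inter> D" "canonical K R" "lex_contains R S" "R \<subseteq> {1..n}"
    "antichain F" "\<And>A B. A \<subseteq> B \<Longrightarrow> B \<in> D \<Longrightarrow> A \<in> D" "\<And>g. g \<in> K \<Longrightarrow> inj g"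
    "correct_prune D F prune" "correct_stop D F stop"
  shows "R \<in> set (slsrs n D F K prune stop S)"
  using assms
proof (induction n D F K prune stop S rule: slsrs.induct)
  case (1 n D F K prune stop S)
  note prems = "1.prems"
  show ?case
  proof (cases "S \<in> F")
    case True
    \<comment> \<open>The search returns at the first feasible set it meets; the antichain property
      ensures that this is not a proper subset of \<open>R\<close>.\<close>
    then have "S = R" using prems(1,3,5) by (auto simp: antichain_def lex_contains_def)
    then show ?thesis using True by (simp add: slsrs.simps[of _ _ _ _ _ _ R])
  next
    case False
    then have "R \<noteq> S" using prems by auto
    have "finite R" using prems(4) finite_subset by blast
    obtain j where j: "lex_contains R (insert j S)" "j \<in> R" "\<forall>i\<in>S. i < j"
      using lex_contains_insert_Min[OF prems(3) \<open>finite R\<close> \<open>R \<noteq> S\<close>] by blast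
    let ?js = "takeWhile (\<lambda>j. \<not> stop S j) (filter (\<lambda>j. \<forall>i\<in>S. i < j) [1..<Suc n])"
    have js: "j \<in> set ?js"
    proof (rule in_set_takeWhile_sorted)
      show "sorted (filter (\<lambda>j. \<forall>i\<in>S. i < j) [1..<Suc n])"
        by (intro sorted_wrt_filter sorted_upt)
      show "j \<in> set (filter (\<lambda>j. \<forall>i\<in>S. i < j) [1..<Suc n])"
        using j prems(4) by auto
      \<comment> \<open>Leaving the loop at \<open>k\<close> would rule out all later expansions
        too, among them \<open>j\<close>, which leads to \<open>R\<close>.\<close>
      show "\<not> stop S k" if "k \<le> j" for k
        using prems(1,9) j that unfolding correct_stop_def by blast
    qed
    have "insert j S \<subseteq> R" using j by (auto simp: lex_contains_def)
    then have D: "insert j S \<in> D" using prems by blast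
    have can: "canonical K (insert j S)"
      using canonical_initial_segment prems(2,7) j(1) \<open>finite R\<close> by blast
    have pr: "\<not> prune (insert j S)"
      using prems(1,8) j(1) unfolding correct_prune_def by blast
    have "R \<in> set (slsrs n D F K prune stop (insert j S))"
      using "1.IH"[OF False js] D can pr prems j(1) by blast
    then show ?thesis
      using False js D can pr by (subst slsrs.simps) (auto simp del: upt_Suc)
  qed
qed

lemma slsrs_outputs_canonical:
  assumes "antichain F" "{} \<in> D" "\<And>A B. A \<subseteq> B \<Longrightarrow> B \<in> D \<Longrightarrow> A \<in> D" "D \<subseteq> Pow {1..n}"
    "subgroup K (sym_group n)" "correct_prune D F prune" "correct_stop D F stop"
  shows "outputs_canonical K (F \<inter> D) (slsrs n D F K prune stop {})"
proof -
  have inj: "inj g" if "g \<in> K" for g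
    by (rule permutes_inj[OF subgroup_sym_group_permutes[OF assms(5) that]])
  have "set (slsrs n D F K prune stop {}) = {S \<in> F \<inter> D. canonical K S}"
  proof (intro equalityI subsetI)
    fix R assume "R \<in> set (slsrs n D F K prune stop {})"
    \<comment> \<open>The root is output untested if feasible, so for \<open>R = {}\<close>
      membership in \<open>D\<close> and canonicity are supplied separately.\<close>
    from slsrs_sound[OF this] show "R \<in> {S \<in> F \<inter> D. canonical K S}"
      using assms(2) canonical_empty by (cases "R = {}") auto
  next
    fix R assume R: "R \<in> {S \<in> F \<inter> D. canonical K S}"
    have "lex_contains R {}" by (simp add: lex_contains_def)
    then show "R \<in> set (slsrs n D F K prune stop {})"
      using R assms inj by (intro slsrs_complete) auto
  qed
  then show ?thesis by (simp add: outputs_canonical_def slsrs_distinct)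
qed


section \<open>Cliques of the compatibility graph\<close>

lemma cliques_subset: "A \<subseteq> B \<Longrightarrow> B \<in> cliques V E \<Longrightarrow> A \<in> cliques V E"
  by (auto simp: cliques_def)

lemma H_compatible_sym: "H_compatible n E H i j \<longleftrightarrow> H_compatible n E H j i"
  by (auto simp: H_compatible_def Un_commute)

lemma H_downset_subset_Pow: "H_downset n E H \<subseteq> Pow {1..n}"
  by (auto simp: H_downset_def cliques_def H_nodes_def H_feasible_def)

text \<open>An edge of the compatibility graph bundles adjacency with compatibility. The nodes
  supply the diagonal case, where compatibility is feasibility, since the clique condition speaks of
  distinct elements only.\<close>

lemma H_downset_iff:
  "S \<in> H_downset n E H \<longleftrightarrow> S \<in> cliques {1..n} E \<and> pairwise_H_compatible n E H S"
proof (intro iffI conjI)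
  assume S: "S \<in> H_downset n E H"
  then have nodes: "H_feasible n E H i" if "i \<in> S" for i
    using that by (auto simp: H_downset_def cliques_def H_nodes_def)
  have edges: "{i, j} \<in> E \<and> H_compatible n E H i j" if "i \<in> S" "j \<in> S" "i \<noteq> j" for i j
  proof -
    have "{i, j} \<in> H_edges n E H" using S that by (simp add: H_downset_def cliques_def)
    then obtain k l where "{i, j} = {k, l}" "{k, l} \<in> E" "H_compatible n E H k l"
      by (auto simp: H_edges_def)
    \<comment> \<open>The edge may name its ends in reverse order, so symmetry of compatibility
      enters.\<close>
    then show ?thesis by (metis H_compatible_sym doubleton_eq_iff)
  qed
  show "S \<in> cliques {1..n} E"
    using edges subsetD[OF H_downset_subset_Pow S] by (simp add: cliques_def)
  show "pairwise_H_compatible n E H S"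
    unfolding pairwise_H_compatible_def
  proof (intro ballI)
    show "H_compatible n E H i j" if "i \<in> S" "j \<in> S" for i j
      using that edges nodes by (cases "i = j") (auto simp: H_compatible_def H_feasible_def)
  qed
next
  assume "S \<in> cliques {1..n} E \<and> pairwise_H_compatible n E H S"
  then have "S \<subseteq> H_nodes n E H" "\<forall>i\<in>S. \<forall>j\<in>S. i \<noteq> j \<longrightarrow> {i, j} \<in> H_edges n E H"
    unfolding cliques_def pairwise_H_compatible_def H_edges_def H_nodes_def
    by (auto simp: H_compatible_def[of n E H]) blast+
  then show "S \<in> H_downset n E H"
    by (simp add: H_downset_def cliques_def)
qed

section \<open>Invariance and pairwise compatibility\<close>

lemma maximal_clique_pairwise_H_compatible_invariant:
  assumes H: "subgroup H (sym_group n)" and S: "maximal_clique {1..n} E S"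
    and comp: "pairwise_H_compatible n E H S"
  shows "H_invariant H S"
proof -
  interpret H: subgroup H "sym_group n" by fact
  let ?U = "\<Union>i\<in>S. pt_orbit H i"
  have "i \<in> pt_orbit H i" for i
    using H.one_closed by (auto simp: pt_orbit_def sym_group_one intro!: exI[of _ id])
  then have "S \<subseteq> ?U" by blast
  have pair: "pt_orbit H i \<union> pt_orbit H j \<in> cliques {1..n} E" if "i \<in> S" "j \<in> S" for i j
    using comp that by (simp add: pairwise_H_compatible_def H_compatible_def)
  have "?U \<in> cliques {1..n} E"
    unfolding cliques_def
  proof (intro CollectI conjI ballI impI)
    show "?U \<subseteq> {1..n}" using pair by (fastforce simp: cliques_def)
    fix a b assume "a \<in> ?U" "b \<in> ?U" "a \<noteq> b"
    then obtain i j where "i \<in> S" "j \<in> S" "a \<in> pt_orbit H i" "b \<in> pt_orbit H j" by blast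
    \<comment> \<open>Both points may come from one orbit; \<open>pair\<close> includes the case
      \<open>i = j\<close>.\<close>
    then show "{a, b} \<in> E" using pair[of i j] \<open>a \<noteq> b\<close> by (simp add: cliques_def)
  qed
  then have U: "?U = S" using S \<open>S \<subseteq> ?U\<close> by (simp add: maximal_clique_def)
  have "finite S"
    using S by (auto simp: maximal_clique_def cliques_def intro: finite_subset)
  show ?thesis
    unfolding H_invariant_def
  proof
    fix h assume h: "h \<in> H"
    then have "h ` S \<subseteq> S" using U by (auto simp: pt_orbit_def)
    \<comment> \<open>Equality follows from the inclusion because an injective self-map of a finite
      set is onto.\<close>
    moreover have "inj h" by (rule permutes_inj[OF subgroup_sym_group_permutes[OF H h]])
    ultimately show "h ` S = S"
      using \<open>finite S\<close> by (meson endo_inj_surj inj_on_subset subset_UNIV)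
  qed
qed

lemma invariant_clique_pairwise_H_compatible:
  assumes "H_invariant H S" "S \<in> cliques {1..n} E"
  shows "pairwise_H_compatible n E H S"
proof -
  have orb: "pt_orbit H i \<subseteq> S" if "i \<in> S" for i
    using assms(1) that by (auto simp: H_invariant_def pt_orbit_def)
  have "i \<in> {1..n}" if "i \<in> S" for i
    using assms(2) that by (auto simp: cliques_def)
  then show ?thesis
    using orb cliques_subset[OF _ assms(2)]
    by (simp add: pairwise_H_compatible_def H_compatible_def H_feasible_def)
qed

theorem theorem1:
  fixes n :: nat and E :: "nat set set" and F :: "nat set set"
    and G H :: "(nat \<Rightarrow> nat) set"
  assumes graph: "simple_graph {1..n} E"
    and G_subgroup: "subgroup G (sym_group n)"
    and G_aut: "G \<subseteq> graph_automorphisms {1..n} E"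
    and F_sub: "F \<subseteq> cliques {1..n} E"
    and F_antichain: "antichain F"
    and F_maximal: "\<forall>S\<in>F. maximal_clique {1..n} E S"
    and H_subgroup: "subgroup H (sym_group n)"
  shows "(\<forall>S\<in>F. pairwise_H_compatible n E H S \<longrightarrow> H_invariant H S \<and> S \<in> F) \<and>
    (\<forall>K prune stop.
       subgroup K (sym_group n) \<and> K \<subseteq> H_feasible_symmetries n E G H \<and>
       correct_prune (H_downset n E H) F prune \<and>
       correct_stop (H_downset n E H) F stop \<longrightarrow>
       (let X = {S \<in> F. H_invariant H S};
            outs = slsrs n (H_downset n E H) F K prune stop {}
        in outputs_canonical K X outs \<and>
           (acts_on_family K X \<longrightarrow> enumerates_up_to K X outs)))"
proof -
  let ?D = "H_downset n E H"
  have inv: "H_invariant H S" if "S \<in> F" "pairwise_H_compatible n E H S" for S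
    using maximal_clique_pairwise_H_compatible_invariant[OF H_subgroup] F_maximal that by blast
  \<comment> \<open>From right to left this is \<open>inv\<close>; from left to right, invariant
    cliques are pairwise compatible. It turns the target family into the feasible members of the
    searched downset.\<close>
  have X: "{S \<in> F. H_invariant H S} = F \<inter> ?D"
    using inv invariant_clique_pairwise_H_compatible F_sub H_downset_iff by blast
  have out: "outputs_canonical K (F \<inter> ?D) (slsrs n ?D F K prune stop {})"
    if "subgroup K (sym_group n)" "correct_prune ?D F prune" "correct_stop ?D F stop"
    for K prune stop
  proof (rule slsrs_outputs_canonical)
    show "{} \<in> ?D" by (simp add: H_downset_def cliques_def)
    show "A \<in> ?D" if "A \<subseteq> B" "B \<in> ?D" for A B
      using that cliques_subset unfolding H_downset_def by blast
  qed (use that F_antichain H_downset_subset_Pow in auto)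
  have "finite S" if "S \<in> F \<inter> ?D" for S
    using that H_downset_subset_Pow[of n E H] finite_subset[of S "{1..n}"] by blast
  then show ?thesis
    unfolding X Let_def using inv out outputs_canonical_enumerates by blast
qed

end
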